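(* Consider the following three discrete update maps $(\mathbf\Xi^n,\mathbf V^n,\mathbf e^n,\mathbf b^n)\mapsto(\mathbf\Xi^{n+1},\mathbf V^{n+1},\mathbf e^{n+1},\mathbf b^{n+1})$ with time step $\Delta t$, where $t^{n+1}=t^n+\Delta t$. (S1) With $\mathbf\Xi(\tau)=\frac{(t^{n+1}-\tau)\mathbf\Xi^n+(\tau-t^n)\mathbf\Xi^{n+1}}{\Delta t}$, the new state satisfies $$\frac{\mathbf\Xi^{n+1}-\mathbf\Xi^n}{\Delta t}=\frac{\mathbb N(\mathbf\Xi^n)^\top+\mathbb N(\mathbf\Xi^{n+1})^\top}2\,\frac{\mathbf V^{n+1}+\mathbf V^n}2,$$ $$\frac{\mathbf V^{n+1}-\mathbf V^n}{\Delta t}=\mathbb M_m^{-1}\mathbb M_q\frac{\mathbb N(\mathbf\Xi^n)+\mathbb N(\mathbf\Xi^{n+1})}2\,\frac1{\Delta t}\int_{t^n}^{t^{n+1}}\mathbb L^1(\mathbf\Xi(\tau))\,d\tau\,\frac{\mathbf e^{n+1}+\mathbf e^n}2,$$ $$\frac{\tilde{\mathsf M}_1\mathbf e^{n+1}-\tilde{\mathsf M}_1\mathbf e^n}{\Delta t}=-\frac1{\Delta t}\int_{t^n}^{t^{n+1}}\mathbb L^1(\mathbf\Xi(\tau))^\top d\tau\,\frac{\mathbb N(\mathbf\Xi^n)^\top+\mathbb N(\mathbf\Xi^{n+1})^\top}2\,\mathbb M_q\frac{\mathbf V^{n+1}+\mathbf V^n}2,\qquad\mathbf b^{n+1}=\mathbf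 b^n.$$ (S2) $\mathbf\Xi,\mathbf e,\mathbf b$ unchanged and, with $\mathbb N=\mathbb N(\mathbf\Xi^n)$, $\tilde{\mathbb B}=\tilde{\mathbb B}(\mathbf\Xi^n,\mathbf b^n)$, $$\Big(\mathbb I-\tfrac{\Delta t}2\mathbb M_m^{-1}\mathbb M_q\mathbb N\tilde{\mathbb B}\mathbb N^\top\Big)\mathbf V^{n+1}=\Big(\mathbb I+\tfrac{\Delta t}2\mathbb M_m^{-1}\mathbb M_q\mathbb N\tilde{\mathbb B}\mathbb N^\top\Big)\mathbf V^n.$$ (S3) $\mathbf\Xi,\mathbf V$ unchanged and, with $S=\tilde{\mathsf M}_1+\frac{\Delta t^2}4\mathsf C^\top\tilde{\mathsf M}_2\mathsf C$, $$\mathbf e^{n+1}=S^{-1}\Big(\big(\tilde{\mathsf M}_1-\tfrac{\Delta t^2}4\mathsf C^\top\tilde{\mathsf M}_2\mathsf C\big)\mathbf e^n+\Delta t\,\mathsf C^\top\tilde{\mathsf M}_2\mathbf b^n\Big),\qquad\mathbf b^{n+1}=\mathbf b^n-\tfrac{\Delta t}2\mathsf C(\mathbf e^n+\mathbf e^{n+1}).$$ Then for the splitting scheme that advances the state by successive application of (S1), (S2), (S3), the discrete electric Gauss law $$\mathsf G^\top\tilde{\mathsf M}_1\mathbf e=-\mathbb L^0(\mathbf\Xi)^\top\mathbb M_q^0\,\mathbb 1_{N_p}$$ is preserved over time if it is satisfied initially: if it holds for the initial state, it holds for every state produced by the scheme.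
   Context: Geometry: $\tilde\Omega=[0,1]^3$ and $F:\tilde\Omega\to\Omega\subset\mathbb R^3$ is a smooth bijection with $J_F(\xi)=\det DF(\xi)\neq0$ for all $\xi$. Put $N(\xi)=DF(\xi)^{-\top}$, $G_n=N^\top N$, $G_t=DF^\top DF$. Discrete de Rham sequence on $\tilde\Omega$: there are linearly independent families of basis functions, collected in rows: $\tilde\Lambda^0(\xi)\in\mathbb R^{1\times N_0}$, $\tilde{\mathbf\Lambda}^1(\xi)\in\mathbb R^{3\times3N_1}$, $\tilde{\mathbf\Lambda}^2(\xi)\in\mathbb R^{3\times3N_2}$, $\tilde\Lambda^3(\xi)\in\mathbb R^{1\times N_3}$, and constant matrices $\mathsf G\in\mathbb R^{3N_1\times N_0}$, $\mathsf C\in\mathbb R^{3N_2\times3N_1}$, $\mathsf D\in\mathbb R^{N_3\times3N_2}$ such that (columnwise) $\nabla\tilde\Lambda^0=\tilde{\mathbf\Lambda}^1\mathsf G$, $\nabla\times\tilde{\mathbf\Lambda}^1=\tilde{\mathbf\Lambda}^2\mathsf C$, $\nabla\cdot\tilde{\mathbf\Lambda}^2=\tilde\Lambda^3\mathsf D$, with $\mathsf D\mathsf C=0$, $\mathsf C\mathsf G=0$. Basis functions are assumed smooth enough that these derivatives exist classically and the chain rule applies. Mass matrices: $\tilde{\mathsf M}_1=\int_{\tilde\Omega}(\tilde{\mathbf\Lambda}^1)^\top G_n\tilde{\mathbf\Lambda}^1|J_F|\,d\xi$, $\tilde{\mathsf M}_2=\int_{\tilde\Omega}(\tilde{\mathbf\Lambda}^2)^\top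 G_t\tilde{\mathbf\Lambda}^2\frac1{|J_F|}\,d\xi$ (symmetric positive definite). Particles: $N_p$ particles with logical positions $\xi_p\in\tilde\Omega$, velocities $v_p\in\mathbb R^3$, constant weights $\omega_p>0$, masses $m_p>0$, charges $q_p$. $\mathbf\Xi=(\xi_1,\dots,\xi_{N_p})$, $\mathbf V=(v_1,\dots,v_{N_p})$; $\mathbf e\in\mathbb R^{3N_1}$, $\mathbf b\in\mathbb R^{3N_2}$ are the field coefficients. $\mathbb M_m=\mathrm{diag}(\omega_pm_p)\otimes\mathbb I_3$, $\mathbb M_q=\mathrm{diag}(\omega_pq_p)\otimes\mathbb I_3$, $\mathbb M^0_q=\mathrm{diag}(\omega_pq_p)\in\mathbb R^{N_p\times N_p}$; $\mathbb N(\mathbf\Xi)$ is block diagonal with blocks $N(\xi_p)$; $\mathbb L^0(\mathbf\Xi)\in\mathbb R^{N_p\times N_0}$ has rows $\tilde\Lambda^0(\xi_p)$; $\mathbb L^1(\mathbf\Xi)\in\mathbb R^{3N_p\times3N_1}$ is obtained by stacking the blocks $\tilde{\mathbf\Lambda}^1(\xi_p)$; $\tilde{\mathbb B}(\mathbf\Xi,\mathbf b)$ is block diagonal with $p$-th block the matrix of $w\mapsto w\times\tilde{\mathbf\Lambda}^2(\xi_p)\mathbf b$; $\mathbb 1_{N_p}$ is the all-ones vector. The updates may be composed in any order, each substep possibly with its own step size; it is assumed that the implicit update (S1) has a solution with positions in $\tilde\Omega$ and that the scheme uses such a solution. *)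

theory Defs
  imports "HOL-Analysis.Analysis"
begin

unbundle cross3_syntax

abbreviation logical_cube :: "(real^3) set" where
  "logical_cube \<equiv> cbox 0 1"

text \<open>
  All derivatives on a set \<open>S\<close> are Frechet derivatives \<open>within S\<close>, i.e. one-sided on the boundary
  of the closed cube; on the cube they are unique. \<open>f\<close> is of class \<open>C^(k+1)\<close> if it is
  differentiable and all its directional derivatives are of class \<open>C^k\<close>.
\<close>

primrec Ck_on ::
  "nat \<Rightarrow> ('a::real_normed_vector \<Rightarrow> 'b::real_normed_vector) \<Rightarrow> 'a set \<Rightarrow> bool" where
  "Ck_on 0 f S \<longleftrightarrow> continuous_on S f"
| "Ck_on (Suc k) f S \<longleftrightarrow>
     (\<exists>f'. (\<forall>x\<in>S. (f has_derivative f' x) (at x within S)) \<and> (\<forall>v. Ck_on k (\<lambda>x. f' x v) S))"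

definition smooth_on ::
  "('a::real_normed_vector \<Rightarrow> 'b::real_normed_vector) \<Rightarrow> 'a set \<Rightarrow> bool" where
  "smooth_on f S \<longleftrightarrow> (\<forall>k. Ck_on k f S)"

definition DF :: "(real^3 \<Rightarrow> real^3) \<Rightarrow> real^3 \<Rightarrow> real^3^3" where
  "DF F \<xi> = jacobian F (at \<xi> within logical_cube)"

definition J_F :: "(real^3 \<Rightarrow> real^3) \<Rightarrow> real^3 \<Rightarrow> real" where
  "J_F F \<xi> = det (DF F \<xi>)"

definition N_F :: "(real^3 \<Rightarrow> real^3) \<Rightarrow> real^3 \<Rightarrow> real^3^3" where
  "N_F F \<xi> = transpose (matrix_inv (DF F \<xi>))"

definition G_n :: "(real^3 \<Rightarrow> real^3) \<Rightarrow> real^3 \<Rightarrow> real^3^3" where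
  "G_n F \<xi> = transpose (N_F F \<xi>) ** N_F F \<xi>"

definition G_t :: "(real^3 \<Rightarrow> real^3) \<Rightarrow> real^3 \<Rightarrow> real^3^3" where
  "G_t F \<xi> = transpose (DF F \<xi>) ** DF F \<xi>"

definition pderiv_cube :: "3 \<Rightarrow> (real^3 \<Rightarrow> real) \<Rightarrow> real^3 \<Rightarrow> real" where
  "pderiv_cube i f \<xi> = frechet_derivative f (at \<xi> within logical_cube) (axis i 1)"

definition grad :: "(real^3 \<Rightarrow> real) \<Rightarrow> real^3 \<Rightarrow> real^3" where
  "grad f \<xi> = (\<chi> i. pderiv_cube i f \<xi>)"

definition curl :: "(real^3 \<Rightarrow> real^3) \<Rightarrow> real^3 \<Rightarrow> real^3" where
  "curl u \<xi> = vector
     [pderiv_cube 2 (\<lambda>\<eta>. u \<eta> $ 3) \<xi> - pderiv_cube 3 (\<lambda>\<eta>. u \<eta> $ 2) \<xi>,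
      pderiv_cube 3 (\<lambda>\<eta>. u \<eta> $ 1) \<xi> - pderiv_cube 1 (\<lambda>\<eta>. u \<eta> $ 3) \<xi>,
      pderiv_cube 1 (\<lambda>\<eta>. u \<eta> $ 2) \<xi> - pderiv_cube 2 (\<lambda>\<eta>. u \<eta> $ 1) \<xi>]"

definition divergence :: "(real^3 \<Rightarrow> real^3) \<Rightarrow> real^3 \<Rightarrow> real" where
  "divergence u \<xi> = (\<Sum>i\<in>UNIV. pderiv_cube i (\<lambda>\<eta>. u \<eta> $ i) \<xi>)"

text \<open>
  A family of basis functions is the matrix of its values, one column per function; the
  dimensions \<open>3 N_1\<close> and \<open>3 N_2\<close> are the index types \<open>3 \<times> 'n1\<close> and \<open>3 \<times> 'n2\<close>.
\<close>

definition lin_indep_family :: "(real^3 \<Rightarrow> real^'n^'k) \<Rightarrow> bool" where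
  "lin_indep_family \<Lambda> \<longleftrightarrow> (\<forall>c. (\<forall>\<xi>\<in>logical_cube. \<Lambda> \<xi> *v c = 0) \<longrightarrow> c = 0)"

definition discrete_de_rham ::
  "(real^3 \<Rightarrow> real^'n0^1) \<Rightarrow> (real^3 \<Rightarrow> real^(3 \<times> 'n1::finite)^3) \<Rightarrow>
   (real^3 \<Rightarrow> real^(3 \<times> 'n2::finite)^3) \<Rightarrow> (real^3 \<Rightarrow> real^'n3^1) \<Rightarrow>
   real^'n0^(3 \<times> 'n1) \<Rightarrow> real^(3 \<times> 'n1)^(3 \<times> 'n2) \<Rightarrow> real^(3 \<times> 'n2)^'n3 \<Rightarrow> bool" where
  "discrete_de_rham \<Lambda>0 \<Lambda>1 \<Lambda>2 \<Lambda>3 G C D \<longleftrightarrow>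
     lin_indep_family \<Lambda>0 \<and> lin_indep_family \<Lambda>1 \<and> lin_indep_family \<Lambda>2 \<and> lin_indep_family \<Lambda>3 \<and>
     \<Lambda>0 differentiable_on logical_cube \<and>
     \<Lambda>1 differentiable_on logical_cube \<and>
     \<Lambda>2 differentiable_on logical_cube \<and>
     (\<forall>\<xi>\<in>logical_cube.
        (\<forall>j. grad (\<lambda>\<eta>. \<Lambda>0 \<eta> $ 1 $ j) \<xi> = column j (\<Lambda>1 \<xi> ** G)) \<and>
        (\<forall>j. curl (\<lambda>\<eta>. column j (\<Lambda>1 \<eta>)) \<xi> = column j (\<Lambda>2 \<xi> ** C)) \<and>
        (\<forall>j. divergence (\<lambda>\<eta>. column j (\<Lambda>2 \<eta>)) \<xi> = (\<Lambda>3 \<xi> ** D) $ 1 $ j)) \<and>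
     D ** C = 0 \<and> C ** G = 0"

definition M1 :: "(real^3 \<Rightarrow> real^3) \<Rightarrow> (real^3 \<Rightarrow> real^(3 \<times> 'n1::finite)^3) \<Rightarrow>
    real^(3 \<times> 'n1)^(3 \<times> 'n1)" where
  "M1 F \<Lambda>1 = integral logical_cube
     (\<lambda>\<xi>. \<bar>J_F F \<xi>\<bar> *\<^sub>R (transpose (\<Lambda>1 \<xi>) ** G_n F \<xi> ** \<Lambda>1 \<xi>))"

definition M2 :: "(real^3 \<Rightarrow> real^3) \<Rightarrow> (real^3 \<Rightarrow> real^(3 \<times> 'n2::finite)^3) \<Rightarrow>
    real^(3 \<times> 'n2)^(3 \<times> 'n2)" where
  "M2 F \<Lambda>2 = integral logical_cube
     (\<lambda>\<xi>. (1 / \<bar>J_F F \<xi>\<bar>) *\<^sub>R (transpose (\<Lambda>2 \<xi>) ** G_t F \<xi> ** \<Lambda>2 \<xi>))"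

text \<open>
  Vectors in \<open>R^(3 N_p)\<close> are indexed by \<open>'p \<times> 3\<close> (particle, component).
\<close>

definition particle :: "real^('p::finite \<times> 3) \<Rightarrow> 'p \<Rightarrow> real^3" where
  "particle X p = (\<chi> i. X $ (p, i))"

definition diag_mat :: "('p \<Rightarrow> real) \<Rightarrow> real^'p^'p" where
  "diag_mat d = (\<chi> p q. if p = q then d p else 0)"

definition kron :: "real^'n^'m \<Rightarrow> real^'l^'k \<Rightarrow>
    real^('n::finite \<times> 'l::finite)^('m::finite \<times> 'k::finite)" where
  "kron A B = (\<chi> r c. A $ fst r $ fst c * B $ snd r $ snd c)"

definition block_diag :: "('p \<Rightarrow> real^3^3) \<Rightarrow> real^('p::finite \<times> 3)^('p \<times> 3)" where
  "block_diag A = (\<chi> r c. if fst r = fst c then A (fst r) $ snd r $ snd c else 0)"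

definition stack :: "('p \<Rightarrow> real^'n^3) \<Rightarrow> real^'n^('p::finite \<times> 3)" where
  "stack A = (\<chi> r. A (fst r) $ snd r)"

definition MMm :: "('p \<Rightarrow> real) \<Rightarrow> ('p \<Rightarrow> real) \<Rightarrow> real^('p::finite \<times> 3)^('p \<times> 3)" where
  "MMm \<omega> m = kron (diag_mat (\<lambda>p. \<omega> p * m p)) (mat 1 :: real^3^3)"

definition MMq :: "('p \<Rightarrow> real) \<Rightarrow> ('p \<Rightarrow> real) \<Rightarrow> real^('p::finite \<times> 3)^('p \<times> 3)" where
  "MMq \<omega> q = kron (diag_mat (\<lambda>p. \<omega> p * q p)) (mat 1 :: real^3^3)"

definition MMq0 :: "('p \<Rightarrow> real) \<Rightarrow> ('p \<Rightarrow> real) \<Rightarrow> real^'p^'p" where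
  "MMq0 \<omega> q = diag_mat (\<lambda>p. \<omega> p * q p)"

definition NN :: "(real^3 \<Rightarrow> real^3) \<Rightarrow> real^('p::finite \<times> 3) \<Rightarrow> real^('p \<times> 3)^('p \<times> 3)" where
  "NN F \<Xi> = block_diag (\<lambda>p. N_F F (particle \<Xi> p))"

definition LL0 :: "(real^3 \<Rightarrow> real^'n0^1) \<Rightarrow> real^('p::finite \<times> 3) \<Rightarrow> real^'n0^'p" where
  "LL0 \<Lambda>0 \<Xi> = (\<chi> p. \<Lambda>0 (particle \<Xi> p) $ 1)"

definition LL1 :: "(real^3 \<Rightarrow> real^(3 \<times> 'n1::finite)^3) \<Rightarrow> real^('p::finite \<times> 3) \<Rightarrow>
    real^(3 \<times> 'n1)^('p \<times> 3)" where
  "LL1 \<Lambda>1 \<Xi> = stack (\<lambda>p. \<Lambda>1 (particle \<Xi> p))"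

definition BB :: "(real^3 \<Rightarrow> real^(3 \<times> 'n2::finite)^3) \<Rightarrow> real^('p::finite \<times> 3) \<Rightarrow>
    real^(3 \<times> 'n2) \<Rightarrow> real^('p \<times> 3)^('p \<times> 3)" where
  "BB \<Lambda>2 \<Xi> b = block_diag (\<lambda>p. matrix (\<lambda>w. w \<times> (\<Lambda>2 (particle \<Xi> p) *v b)))"

type_synonym ('p, 'n1, 'n2) state =
  "(real^('p \<times> 3)) \<times> (real^('p \<times> 3)) \<times> (real^(3 \<times> 'n1)) \<times> (real^(3 \<times> 'n2))"

fun positions_in_cube :: "('p::finite, 'n1::finite, 'n2::finite) state \<Rightarrow> bool" where
  "positions_in_cube (\<Xi>, V, e, b) \<longleftrightarrow> (\<forall>p. particle \<Xi> p \<in> logical_cube)"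

definition straight_path :: "real \<Rightarrow> real \<Rightarrow> real^'d \<Rightarrow> real^'d \<Rightarrow> real \<Rightarrow> real^'d" where
  "straight_path t \<Delta>t \<Xi> \<Xi>' \<tau> = (1 / \<Delta>t) *\<^sub>R ((t + \<Delta>t - \<tau>) *\<^sub>R \<Xi> + (\<tau> - t) *\<^sub>R \<Xi>')"

text \<open>
  The integrals over \<open>[t, t + \<Delta>t]\<close> are oriented interval integrals, so that the
  formulas also make sense for negative substeps, as used in higher-order compositions.
\<close>

fun update_S1 :: "(real^3 \<Rightarrow> real^3) \<Rightarrow> (real^3 \<Rightarrow> real^(3 \<times> 'n1)^3) \<Rightarrow>
    ('p::finite \<Rightarrow> real) \<Rightarrow> ('p \<Rightarrow> real) \<Rightarrow> ('p \<Rightarrow> real) \<Rightarrow> real \<Rightarrow> real \<Rightarrow>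
    ('p, 'n1::finite, 'n2::finite) state \<Rightarrow> ('p, 'n1, 'n2) state \<Rightarrow> bool" where
  "update_S1 F \<Lambda>1 \<omega> m q t \<Delta>t (\<Xi>, V, e, b) (\<Xi>', V', e', b') \<longleftrightarrow>
     (1 / \<Delta>t) *\<^sub>R (\<Xi>' - \<Xi>) =
       ((1 / 2) *\<^sub>R (transpose (NN F \<Xi>) + transpose (NN F \<Xi>'))) *v ((1 / 2) *\<^sub>R (V' + V)) \<and>
     (1 / \<Delta>t) *\<^sub>R (V' - V) =
       (matrix_inv (MMm \<omega> m) ** MMq \<omega> q ** ((1 / 2) *\<^sub>R (NN F \<Xi> + NN F \<Xi>')) **
        ((1 / \<Delta>t) *\<^sub>R (LBINT \<tau>=ereal t..ereal (t + \<Delta>t). LL1 \<Lambda>1 (straight_path t \<Delta>t \<Xi> \<Xi>' \<tau>))))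
       *v ((1 / 2) *\<^sub>R (e' + e)) \<and>
     (1 / \<Delta>t) *\<^sub>R (M1 F \<Lambda>1 *v e' - M1 F \<Lambda>1 *v e) =
       - ((((1 / \<Delta>t) *\<^sub>R
             (LBINT \<tau>=ereal t..ereal (t + \<Delta>t). transpose (LL1 \<Lambda>1 (straight_path t \<Delta>t \<Xi> \<Xi>' \<tau>)))) **
           ((1 / 2) *\<^sub>R (transpose (NN F \<Xi>) + transpose (NN F \<Xi>'))) ** MMq \<omega> q)
          *v ((1 / 2) *\<^sub>R (V' + V))) \<and>
     b' = b"

fun update_S2 :: "(real^3 \<Rightarrow> real^3) \<Rightarrow> (real^3 \<Rightarrow> real^(3 \<times> 'n2)^3) \<Rightarrow>
    ('p::finite \<Rightarrow> real) \<Rightarrow> ('p \<Rightarrow> real) \<Rightarrow> ('p \<Rightarrow> real) \<Rightarrow> real \<Rightarrow>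
    ('p, 'n1::finite, 'n2::finite) state \<Rightarrow> ('p, 'n1, 'n2) state \<Rightarrow> bool" where
  "update_S2 F \<Lambda>2 \<omega> m q \<Delta>t (\<Xi>, V, e, b) (\<Xi>', V', e', b') \<longleftrightarrow>
     \<Xi>' = \<Xi> \<and> e' = e \<and> b' = b \<and>
     (let A = matrix_inv (MMm \<omega> m) ** MMq \<omega> q ** NN F \<Xi> ** BB \<Lambda>2 \<Xi> b ** transpose (NN F \<Xi>)
      in (mat 1 - (\<Delta>t / 2) *\<^sub>R A) *v V' = (mat 1 + (\<Delta>t / 2) *\<^sub>R A) *v V)"

fun update_S3 :: "(real^3 \<Rightarrow> real^3) \<Rightarrow> (real^3 \<Rightarrow> real^(3 \<times> 'n1)^3) \<Rightarrow>
    (real^3 \<Rightarrow> real^(3 \<times> 'n2)^3) \<Rightarrow> real^(3 \<times> 'n1)^(3 \<times> 'n2) \<Rightarrow> real \<Rightarrow>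
    ('p::finite, 'n1::finite, 'n2::finite) state \<Rightarrow> ('p, 'n1, 'n2) state \<Rightarrow> bool" where
  "update_S3 F \<Lambda>1 \<Lambda>2 C \<Delta>t (\<Xi>, V, e, b) (\<Xi>', V', e', b') \<longleftrightarrow>
     \<Xi>' = \<Xi> \<and> V' = V \<and>
     (let K = (\<Delta>t\<^sup>2 / 4) *\<^sub>R (transpose C ** M2 F \<Lambda>2 ** C)
      in e' = matrix_inv (M1 F \<Lambda>1 + K) *v
                ((M1 F \<Lambda>1 - K) *v e + \<Delta>t *\<^sub>R ((transpose C ** M2 F \<Lambda>2) *v b))) \<and>
     b' = b - (\<Delta>t / 2) *\<^sub>R (C *v (e + e'))"

text \<open>
  The updates may be composed in any order, each with its own step size, so the states produced
  by the scheme are those reachable under the reflexive transitive closure of \<open>substep\<close>. The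
  equations of the first update do not depend on the choice of the starting time \<open>t\<close>.
\<close>

definition substep :: "(real^3 \<Rightarrow> real^3) \<Rightarrow> (real^3 \<Rightarrow> real^(3 \<times> 'n1)^3) \<Rightarrow>
    (real^3 \<Rightarrow> real^(3 \<times> 'n2)^3) \<Rightarrow> real^(3 \<times> 'n1)^(3 \<times> 'n2) \<Rightarrow>
    ('p::finite \<Rightarrow> real) \<Rightarrow> ('p \<Rightarrow> real) \<Rightarrow> ('p \<Rightarrow> real) \<Rightarrow>
    ('p, 'n1::finite, 'n2::finite) state \<Rightarrow> ('p, 'n1, 'n2) state \<Rightarrow> bool" where
  "substep F \<Lambda>1 \<Lambda>2 C \<omega> m q s s' \<longleftrightarrow>
     (\<exists>t \<Delta>t. \<Delta>t \<noteq> 0 \<and>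
        (update_S1 F \<Lambda>1 \<omega> m q t \<Delta>t s s' \<and> positions_in_cube s' \<or>
         update_S2 F \<Lambda>2 \<omega> m q \<Delta>t s s' \<or>
         update_S3 F \<Lambda>1 \<Lambda>2 C \<Delta>t s s'))"

fun gauss_law :: "(real^3 \<Rightarrow> real^3) \<Rightarrow> (real^3 \<Rightarrow> real^'n0^1) \<Rightarrow>
    (real^3 \<Rightarrow> real^(3 \<times> 'n1)^3) \<Rightarrow> real^'n0^(3 \<times> 'n1) \<Rightarrow>
    ('p::finite \<Rightarrow> real) \<Rightarrow> ('p \<Rightarrow> real) \<Rightarrow>
    ('p, 'n1::finite, 'n2::finite) state \<Rightarrow> bool" where
  "gauss_law F \<Lambda>0 \<Lambda>1 G \<omega> q (\<Xi>, V, e, b) \<longleftrightarrow>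
     (transpose G ** M1 F \<Lambda>1) *v e = - ((transpose (LL0 \<Lambda>0 \<Xi>) ** MMq0 \<omega> q) *v vec 1)"

end

theory Submission
  imports Defs
begin

text \<open>
  Both sides of Gauss's law can change only in the first update, so each update is considered
  separately.

  The first update is the substantial one. Multiply the field equation by \<open>G\<^sup>T\<close>. Since
  \<open>M_q\<close> is a multiple of the identity on each particle, it commutes with the averaged block
  matrix \<open>N\<^sup>T\<close>, and the position equation turns \<open>N\<^sup>T V\<close> into the constant velocity
  \<open>w = (\<Xi>' - \<Xi>) / \<Delta>t\<close> of the straight particle paths. What remains is the integral over the
  time step of \<open>\<Sum>\<^sub>p \<omega>\<^sub>p q\<^sub>p (\<Lambda>\<^sup>1(\<xi>\<^sub>p) G)\<^sup>T w\<^sub>p\<close>. Because \<open>\<Lambda>\<^sup>1 G\<close> is the gradient of \<open>\<Lambda>\<^sup>0\<close>,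
  this integrand is the time derivative of \<open>\<Sum>\<^sub>p \<omega>\<^sub>p q\<^sub>p \<Lambda>\<^sup>0(\<xi>\<^sub>p)\<close>, so by the fundamental theorem
  of calculus the integral is exactly the change of the deposited charge
  (\<open>discrete_continuity_equation\<close>). Convexity of the cube keeps the paths inside the domain
  where the gradient identity is known.

  The second update changes only velocities, which do not enter the law.

  In the third update positions are fixed, and every term of \<open>S e' = \<dots>\<close> other than those with
  \<open>M\<^sub>1\<close> starts with \<open>C\<^sup>T\<close>. These are annihilated by \<open>G\<^sup>T\<close> because \<open>C G = 0\<close>, which leaves
  \<open>G\<^sup>T M\<^sub>1 e' = G\<^sup>T M\<^sub>1 e\<close> (\<open>update_S3_preserves_discrete_divergence\<close>). The one analytic point
  is that \<open>S\<close> is invertible, so that \<open>S S\<inverse> = 1\<close>: the matrix \<open>M\<^sub>1\<close> is positive definite and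
  \<open>C\<^sup>T M\<^sub>2 C\<close> is positive semidefinite. Definiteness of \<open>M\<^sub>1\<close> needs its integrand to be
  continuous, hence continuity of the inverse of \<open>DF\<close>, and linear independence of \<open>\<Lambda>\<^sup>1\<close>.
\<close>

section \<open>Matrices depending continuously on a parameter\<close>

lemma inner_matrix_transpose:
  fixes A :: "real^'n^'m"
  shows "x \<bullet> (transpose A *v y) = (A *v x) \<bullet> y"
  by (metis dot_lmul_matrix inner_commute transpose_matrix_vector)

lemma matrix_inv_inverse:
  fixes A :: "real^'n^'n"
  assumes "invertible A"
  shows "A ** matrix_inv A = mat 1" "matrix_inv A ** A = mat 1"
  using someI_ex[OF assms[unfolded invertible_def]] unfolding matrix_inv_def by auto

lemma continuous_on_matrix_iff:
  fixes A :: "'a::topological_space \<Rightarrow> real^'n^'m"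
  shows "continuous_on S A \<longleftrightarrow> (\<forall>i j. continuous_on S (\<lambda>x. A x $ i $ j))"
proof
  assume "continuous_on S A"
  then show "\<forall>i j. continuous_on S (\<lambda>x. A x $ i $ j)"
    by (intro allI continuous_on_component)
next
  assume "\<forall>i j. continuous_on S (\<lambda>x. A x $ i $ j)"
  then have "continuous_on S (\<lambda>x. \<chi> i j. A x $ i $ j)"
    by (intro continuous_on_vec_lambda) auto
  then show "continuous_on S A" by simp
qed

lemma continuous_on_matrix_mult:
  fixes A :: "'a::topological_space \<Rightarrow> real^'n^'m" and B :: "'a \<Rightarrow> real^'k^'n"
  assumes "continuous_on S A" "continuous_on S B"
  shows "continuous_on S (\<lambda>x. A x ** B x)"
  using assms
  by (auto simp: continuous_on_matrix_iff matrix_matrix_mult_def intro!: continuous_intros)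

lemma continuous_on_transpose:
  fixes A :: "'a::topological_space \<Rightarrow> real^'n^'m"
  assumes "continuous_on S A"
  shows "continuous_on S (\<lambda>x. transpose (A x))"
  using assms by (auto simp: continuous_on_matrix_iff transpose_def)

lemma continuous_on_det:
  fixes A :: "'a::topological_space \<Rightarrow> real^'n^'n"
  assumes "continuous_on S A"
  shows "continuous_on S (\<lambda>x. det (A x))"
  using assms by (auto simp: continuous_on_matrix_iff det_def intro!: continuous_intros)

text \<open>
  Cramer's rule writes every entry of the inverse as a quotient of determinants.
\<close>

lemma continuous_on_matrix_inv:
  fixes A :: "'a::topological_space \<Rightarrow> real^'n^'n"
  assumes A: "continuous_on S A" and nz: "\<And>x. x \<in> S \<Longrightarrow> det (A x) \<noteq> 0"
  shows "continuous_on S (\<lambda>x. matrix_inv (A x))"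
proof -
  \<comment> \<open>The \<open>k\<close>-th column of \<open>A x\<close> is replaced by the \<open>l\<close>-th unit vector.\<close>
  let ?B = "\<lambda>k l x. \<chi> i j. if j = k then axis l 1 $ i else A x $ i $ j"
  have entry: "matrix_inv (A x) $ k $ l = det (?B k l x) / det (A x)" if "x \<in> S" for x k l
  proof -
    have inv: "A x ** matrix_inv (A x) = mat 1"
      using nz[OF that] by (simp add: invertible_det_nz matrix_inv_inverse)
    have "A x *v (matrix_inv (A x) *v axis l 1) = axis l 1"
      by (simp add: matrix_vector_mul_assoc inv)
    then have "matrix_inv (A x) *v axis l 1 = (\<chi> k. det (?B k l x) / det (A x))"
      using cramer[OF nz[OF that]] by blast
    then show ?thesis
      by (simp add: matrix_vector_mult_basis column_def vec_eq_iff)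
  qed
  have "continuous_on S (\<lambda>x. det (?B k l x) / det (A x))" for k l
  proof (intro continuous_on_divide continuous_on_det A ballI nz)
    show "continuous_on S (?B k l)"
      unfolding continuous_on_matrix_iff
    proof (intro allI)
      fix i j show "continuous_on S (\<lambda>x. ?B k l x $ i $ j)"
        using A by (cases "j = k") (simp_all add: continuous_on_matrix_iff)
    qed
  qed
  then show ?thesis
    unfolding continuous_on_matrix_iff by (simp add: entry cong: continuous_on_cong)
qed

section \<open>Positive definiteness of the mass matrices\<close>

text \<open>
  Derivatives within a set need not be unique, but they are on a box with nonempty interior. This
  lets the Hilbert choice in \<open>frechet_derivative\<close> be replaced by any derivative at hand.
\<close>

lemma cube_derivative_unique:
  fixes f :: "real^3 \<Rightarrow> 'b::real_normed_vector"
  assumes "\<xi> \<in> logical_cube"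
    and "(f has_derivative f') (at \<xi> within logical_cube)"
    and "(f has_derivative f'') (at \<xi> within logical_cube)"
  shows "f' = f''"
  using assms
  by (intro frechet_derivative_unique_within_closed_interval[of 0 1 \<xi> f f' f''])
    (auto simp: Basis_vec_def inner_axis)

lemma continuous_on_DF:
  assumes "smooth_on F logical_cube"
  shows "continuous_on logical_cube (DF F)"
proof -
  have "Ck_on (Suc 0) F logical_cube" using assms unfolding smooth_on_def by blast
  then obtain F' where F': "\<And>\<xi>. \<xi> \<in> logical_cube \<Longrightarrow> (F has_derivative F' \<xi>) (at \<xi> within logical_cube)"
    and cont: "\<And>v. continuous_on logical_cube (\<lambda>\<xi>. F' \<xi> v)"
    by auto
  have "frechet_derivative F (at \<xi> within logical_cube) = F' \<xi>" if "\<xi> \<in> logical_cube" for \<xi>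
    using that F'[OF that] by (meson cube_derivative_unique differentiable_def frechet_derivative_works)
  then have "DF F \<xi> $ i $ j = F' \<xi> (axis j 1) $ i" if "\<xi> \<in> logical_cube" for \<xi> i j
    using that by (simp add: DF_def jacobian_def matrix_def)
  then show ?thesis
    unfolding continuous_on_matrix_iff
    by (auto cong: continuous_on_cong intro!: continuous_on_component cont)
qed

lemma quadratic_form_integral:
  fixes f :: "'a::euclidean_space \<Rightarrow> real^'n^'n"
  assumes "f integrable_on S"
  shows "x \<bullet> (integral S f *v x) = integral S (\<lambda>\<xi>. x \<bullet> (f \<xi> *v x))"
proof -
  have "linear (\<lambda>A :: real^'n^'n. x \<bullet> (A *v x))"
    by (intro linearI)
      (simp_all add: matrix_vector_mult_add_rdistrib inner_add_right scaleR_matrix_vector_assoc[symmetric])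
  then have "bounded_linear (\<lambda>A :: real^'n^'n. x \<bullet> (A *v x))"
    by (rule linear_conv_bounded_linear[THEN iffD1])
  from integral_linear[OF assms this] show ?thesis by (simp add: o_def)
qed

text \<open>
  The integrands of both mass matrices have this shape, because \<open>G_n\<close> and \<open>G_t\<close> are Gram
  matrices.
\<close>

lemma quadratic_form_congruence:
  fixes B :: "real^'n^'m" and A :: "real^'m^'k"
  shows "x \<bullet> ((c *\<^sub>R (transpose B ** (transpose A ** A) ** B)) *v x) = c * (norm (A *v (B *v x)))\<^sup>2"
proof -
  have "x \<bullet> ((transpose B ** (transpose A ** A) ** B) *v x) = x \<bullet> (transpose B *v (transpose A *v (A *v (B *v x))))"
    by (simp add: matrix_vector_mul_assoc matrix_mul_assoc)
  also have "\<dots> = (norm (A *v (B *v x)))\<^sup>2"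
    by (simp only: inner_matrix_transpose power2_norm_eq_inner)
  finally show ?thesis by (simp add: scaleR_matrix_vector_assoc[symmetric])
qed

text \<open>
  The integrand is semidefinite pointwise. When it is not integrable, the integral has the
  default value \<open>0\<close>, which is semidefinite as well.
\<close>

lemma M2_positive_semidefinite: "0 \<le> x \<bullet> (M2 F \<Lambda>2 *v x)"
proof (cases "(\<lambda>\<xi>. (1 / \<bar>J_F F \<xi>\<bar>) *\<^sub>R (transpose (\<Lambda>2 \<xi>) ** G_t F \<xi> ** \<Lambda>2 \<xi>)) integrable_on logical_cube")
  case True
  have nonneg: "0 \<le> integral S f" if "\<And>\<xi>. 0 \<le> f \<xi>" for S and f :: "real^3 \<Rightarrow> real"
    using that by (cases "f integrable_on S") (auto intro: integral_nonneg simp: not_integrable_integral)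
  show ?thesis
    unfolding M2_def quadratic_form_integral[OF True]
    by (rule nonneg) (simp add: G_t_def quadratic_form_congruence)
next
  case False
  then show ?thesis unfolding M2_def by (simp add: not_integrable_integral)
qed

text \<open>
  The quadratic form of \<open>M1\<close> at \<open>x\<close> is the integral of the continuous nonnegative function
  \<open>|J| |N \<Lambda>1 x|\<^sup>2\<close>. If it vanishes, so does the function everywhere on the cube; since \<open>J\<close> is nonzero
  and \<open>N\<close> invertible, \<open>\<Lambda>1 x\<close> is zero, and linear independence gives \<open>x = 0\<close>.
\<close>

lemma M1_positive_definite:
  assumes F: "smooth_on F logical_cube"
    and nz: "\<And>\<xi>. \<xi> \<in> logical_cube \<Longrightarrow> J_F F \<xi> \<noteq> 0"
    and cont: "continuous_on logical_cube \<Lambda>1"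
    and indep: "lin_indep_family \<Lambda>1"
    and nonpos: "x \<bullet> (M1 F \<Lambda>1 *v x) \<le> 0"
  shows "x = 0"
proof -
  let ?f = "\<lambda>\<xi>. \<bar>J_F F \<xi>\<bar> *\<^sub>R (transpose (\<Lambda>1 \<xi>) ** G_n F \<xi> ** \<Lambda>1 \<xi>)"
  let ?h = "\<lambda>\<xi>. \<bar>J_F F \<xi>\<bar> * (norm (N_F F \<xi> *v (\<Lambda>1 \<xi> *v x)))\<^sup>2"
  have nz': "det (DF F \<xi>) \<noteq> 0" if "\<xi> \<in> logical_cube" for \<xi>
    using nz[OF that] by (simp add: J_F_def)
  have N: "continuous_on logical_cube (N_F F)"
    unfolding N_F_def[abs_def]
    by (intro continuous_on_transpose continuous_on_matrix_inv continuous_on_DF F nz')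
  have f: "continuous_on logical_cube ?f"
    unfolding J_F_def G_n_def
    by (intro continuous_intros continuous_on_transpose continuous_on_matrix_mult continuous_on_det
        continuous_on_DF F N cont)
  have eq: "x \<bullet> (?f \<xi> *v x) = ?h \<xi>" for \<xi>
    unfolding G_n_def quadratic_form_congruence ..
  have "linear (\<lambda>A :: real^(3 \<times> 'n)^(3 \<times> 'n). x \<bullet> (A *v x))" for x :: "real^(3 \<times> 'n::finite)"
    by (intro linearI)
      (simp_all add: matrix_vector_mult_add_rdistrib inner_add_right scaleR_matrix_vector_assoc[symmetric])
  then have h: "continuous_on logical_cube ?h"
    unfolding eq[symmetric]
    using linear_continuous_on_compose f by blast
  have "x \<bullet> (M1 F \<Lambda>1 *v x) = integral logical_cube ?h"
    unfolding M1_def by (subst quadratic_form_integral) (simp_all only: eq integrable_continuous f)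
  moreover have "0 \<le> integral logical_cube ?h"
    by (intro integral_nonneg integrable_continuous h) simp
  ultimately have "integral logical_cube ?h = 0" using nonpos by simp
  then have int0: "(?h has_integral 0) logical_cube"
    using integrable_integral[OF integrable_continuous[OF h]] by simp
  have "box (0 :: real^3) 1 \<noteq> {}"
    by (auto simp: box_ne_empty Basis_vec_def inner_axis)
  then have zero: "?h \<xi> = 0" if "\<xi> \<in> logical_cube" for \<xi>
    using has_integral_0_cbox_imp_0[OF h _ int0] that by auto
  have "\<Lambda>1 \<xi> *v x = 0" if \<xi>: "\<xi> \<in> logical_cube" for \<xi>
  proof -
    have "N_F F \<xi> *v (\<Lambda>1 \<xi> *v x) = 0" using zero[OF \<xi>] nz[OF \<xi>] by simp
    moreover have "transpose (DF F \<xi>) ** N_F F \<xi> = mat 1"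
      using nz'[OF \<xi>] unfolding N_F_def
      by (simp add: matrix_transpose_mul[symmetric] matrix_inv_inverse invertible_det_nz)
    ultimately show ?thesis
      by (metis matrix_vector_mul_assoc matrix_vector_mul_lid matrix_vector_mult_0_right)
  qed
  then show ?thesis using indep unfolding lin_indep_family_def by blast
qed

lemma M1_plus_semidefinite_invertible:
  assumes "smooth_on F logical_cube" "\<And>\<xi>. \<xi> \<in> logical_cube \<Longrightarrow> J_F F \<xi> \<noteq> 0"
    and "continuous_on logical_cube \<Lambda>1" "lin_indep_family \<Lambda>1"
    and K: "\<And>x. 0 \<le> x \<bullet> (K *v x)"
  shows "invertible (M1 F \<Lambda>1 + K)"
  unfolding invertible_left_inverse matrix_left_invertible_ker
proof (intro allI impI)
  fix x assume "(M1 F \<Lambda>1 + K) *v x = 0"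
  then have "x \<bullet> (M1 F \<Lambda>1 *v x) + x \<bullet> (K *v x) = 0"
    by (metis inner_add_right inner_zero_right matrix_vector_mult_add_rdistrib)
  then have "x \<bullet> (M1 F \<Lambda>1 *v x) \<le> 0" using K[of x] by simp
  then show "x = 0" using M1_positive_definite[OF assms(1-4)] by blast
qed

section \<open>The Maxwell update\<close>

text \<open>
  The new field solves \<open>(M1 + K) e' = (M1 - K) e + \<Delta>t C\<^sup>T M2 b\<close> with \<open>K\<close> a multiple of
  \<open>C\<^sup>T M2 C\<close>. As \<open>G\<^sup>T C\<^sup>T = (C G)\<^sup>T = 0\<close>, multiplying by \<open>G\<^sup>T\<close> leaves only the two terms with \<open>M1\<close>.
\<close>

lemma update_S3_preserves_discrete_divergence:
  assumes "smooth_on F logical_cube" "\<And>\<xi>. \<xi> \<in> logical_cube \<Longrightarrow> J_F F \<xi> \<noteq> 0"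
    and "continuous_on logical_cube \<Lambda>1" "lin_indep_family \<Lambda>1"
    and CG: "C ** G = 0"
    and upd: "update_S3 F \<Lambda>1 \<Lambda>2 C \<Delta>t (\<Xi>, V, e, b) (\<Xi>', V', e', b')"
  shows "(transpose G ** M1 F \<Lambda>1) *v e' = (transpose G ** M1 F \<Lambda>1) *v e"
proof -
  define K where "K = (\<Delta>t\<^sup>2 / 4) *\<^sub>R (transpose C ** M2 F \<Lambda>2 ** C)"
  let ?M = "M1 F \<Lambda>1"
  have e': "e' = matrix_inv (?M + K) *v ((?M - K) *v e + \<Delta>t *\<^sub>R ((transpose C ** M2 F \<Lambda>2) *v b))"
    using upd by (simp add: K_def Let_def)
  have "0 \<le> x \<bullet> (K *v x)" for x
  proof -
    have form: "x \<bullet> (K *v x) = (\<Delta>t\<^sup>2 / 4) * (x \<bullet> (transpose C *v (M2 F \<Lambda>2 *v (C *v x))))"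
      by (simp add: K_def scaleR_matrix_vector_assoc[symmetric] matrix_vector_mul_assoc matrix_mul_assoc)
    show ?thesis
      unfolding form inner_matrix_transpose by (simp add: M2_positive_semidefinite)
  qed
  then have inv: "invertible (?M + K)"
    using M1_plus_semidefinite_invertible[OF assms(1-4)] by blast
  have Se': "(?M + K) *v e' = (?M - K) *v e + \<Delta>t *\<^sub>R ((transpose C ** M2 F \<Lambda>2) *v b)"
    unfolding e' by (simp add: matrix_vector_mul_assoc matrix_inv_inverse(1)[OF inv])
  have GC: "transpose G ** transpose C = 0"
    unfolding matrix_transpose_mul[symmetric] CG by (simp add: transpose_def vec_eq_iff)
  then have GCX: "transpose G *v (transpose C *v y) = 0" for y
    by (simp add: matrix_vector_mul_assoc del: transpose_matrix_vector)
  have GK: "transpose G *v (K *v y) = 0" for y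
  proof -
    have "K *v y = (\<Delta>t\<^sup>2 / 4) *\<^sub>R (transpose C *v (M2 F \<Lambda>2 *v (C *v y)))"
      by (simp add: K_def scaleR_matrix_vector_assoc[symmetric] matrix_vector_mul_assoc matrix_mul_assoc)
    then show ?thesis by (simp add: matrix_vector_mult_scaleR GCX del: transpose_matrix_vector)
  qed
  have "transpose G *v ((?M + K) *v e') =
      transpose G *v ((?M - K) *v e + \<Delta>t *\<^sub>R (transpose C *v (M2 F \<Lambda>2 *v b)))"
    unfolding Se' by (simp add: matrix_vector_mul_assoc)
  then show ?thesis
    by (simp add: matrix_vector_mult_add_rdistrib matrix_vector_mult_diff_rdistrib
        matrix_vector_right_distrib matrix_vector_mult_diff_distrib
        matrix_vector_mult_scaleR GCX GK matrix_vector_mul_assoc[symmetric]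
        del: transpose_matrix_vector)
qed

section \<open>Integrals and derivatives along particle paths\<close>

lemma interval_integral_bounded_linear:
  fixes f :: "real \<Rightarrow> 'a::{banach, second_countable_topology}"
    and T :: "'a \<Rightarrow> 'b::{banach, second_countable_topology}"
  assumes T: "bounded_linear T" and f: "interval_lebesgue_integrable M a b f"
  shows "interval_lebesgue_integral M a b (\<lambda>x. T (f x)) = T (interval_lebesgue_integral M a b f)"
proof -
  interpret bounded_linear T by fact
  have "(LINT x:A|M. T (f x)) = T (LINT x:A|M. f x)" if "set_integrable M A f" for A
    using integral_bounded_linear[OF T that[unfolded set_integrable_def]]
    by (simp add: set_lebesgue_integral_def scaleR)
  then show ?thesis
    using f by (auto simp: interval_lebesgue_integral_def interval_lebesgue_integrable_def neg)
qed

lemma interval_integrable_continuous_on_oriented: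
  fixes f :: "real \<Rightarrow> 'a::euclidean_space" and a b :: real
  assumes "continuous_on {min a b..max a b} f"
  shows "interval_lebesgue_integrable lborel a b f"
proof (cases "a \<le> b")
  case True
  then show ?thesis using assms by (intro interval_integrable_continuous_on) simp_all
next
  case False
  then show ?thesis using assms
    by (subst interval_integrable_endpoints_reverse, intro interval_integrable_continuous_on) simp_all
qed

text \<open>
  The gradient identity of the de Rham sequence speaks of single partial derivatives of single
  components. Assembled into the derivative of the whole row of basis functions, it can be used
  in the chain rule.
\<close>

lemma \<Lambda>0_has_derivative:
  fixes \<Lambda>0 :: "real^3 \<Rightarrow> real^'n0^1"
  assumes dR: "discrete_de_rham \<Lambda>0 \<Lambda>1 \<Lambda>2 \<Lambda>3 G C D" and \<xi>: "\<xi> \<in> logical_cube"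
  shows "((\<lambda>\<eta>. \<Lambda>0 \<eta> $ 1) has_derivative (\<lambda>v. transpose (\<Lambda>1 \<xi> ** G) *v v)) (at \<xi> within logical_cube)"
proof -
  obtain D0 where D0: "(\<Lambda>0 has_derivative D0) (at \<xi> within logical_cube)"
    using dR \<xi> unfolding discrete_de_rham_def differentiable_on_def differentiable_def by blast
  have comp: "((\<lambda>\<eta>. \<Lambda>0 \<eta> $ 1 $ j) has_derivative (\<lambda>v. D0 v $ 1 $ j)) (at \<xi> within logical_cube)" for j
    by (intro bounded_linear.has_derivative[OF bounded_linear_vec_nth] D0)
  have "D0 v $ 1 = transpose (\<Lambda>1 \<xi> ** G) *v v" for v
  proof (subst vec_eq_iff, rule allI)
    fix j
    let ?d = "\<lambda>v. D0 v $ 1 $ j"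
    have "grad (\<lambda>\<eta>. \<Lambda>0 \<eta> $ 1 $ j) \<xi> = column j (\<Lambda>1 \<xi> ** G)"
      using dR \<xi> unfolding discrete_de_rham_def by blast
    moreover have "frechet_derivative (\<lambda>\<eta>. \<Lambda>0 \<eta> $ 1 $ j) (at \<xi> within logical_cube) = ?d"
      using \<xi> comp by (meson cube_derivative_unique differentiable_def frechet_derivative_works)
    ultimately have entry: "?d (axis i 1) = (\<Lambda>1 \<xi> ** G) $ i $ j" for i
      by (simp add: grad_def pderiv_cube_def column_def vec_eq_iff)
    have lin: "linear ?d" using comp by (rule has_derivative_linear)
    have "?d v = ?d (\<Sum>i\<in>UNIV. v $ i *\<^sub>R axis i 1)"
      by (simp add: basis_expansion scalar_mult_eq_scaleR[symmetric])
    also have "\<dots> = (\<Sum>i\<in>UNIV. v $ i * ?d (axis i 1))"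
      by (simp add: linear_sum[OF lin] linear_scale[OF lin])
    also have "\<dots> = (transpose (\<Lambda>1 \<xi> ** G) *v v) $ j"
      unfolding entry by (simp add: matrix_vector_mult_def transpose_def mult.commute)
    finally show "?d v = (transpose (\<Lambda>1 \<xi> ** G) *v v) $ j" .
  qed
  moreover have "((\<lambda>\<eta>. \<Lambda>0 \<eta> $ 1) has_derivative (\<lambda>v. D0 v $ 1)) (at \<xi> within logical_cube)"
    by (intro bounded_linear.has_derivative[OF bounded_linear_vec_nth] D0)
  ultimately show ?thesis by simp
qed

lemma particle_add: "particle (X + Y) p = particle X p + particle Y p"
  by (simp add: particle_def vec_eq_iff)

lemma particle_scaleR: "particle (c *\<^sub>R X) p = c *\<^sub>R particle X p"
  by (simp add: particle_def vec_eq_iff)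

lemma straight_path_in_cube:
  assumes dt: "\<Delta>t \<noteq> 0" and "min t (t + \<Delta>t) \<le> \<tau>" "\<tau> \<le> max t (t + \<Delta>t)"
    and "particle \<Xi> p \<in> logical_cube" "particle \<Xi>' p \<in> logical_cube"
  shows "particle (straight_path t \<Delta>t \<Xi> \<Xi>' \<tau>) p \<in> logical_cube"
proof -
  have "particle (straight_path t \<Delta>t \<Xi> \<Xi>' \<tau>) p =
      ((t + \<Delta>t - \<tau>) / \<Delta>t) *\<^sub>R particle \<Xi> p + ((\<tau> - t) / \<Delta>t) *\<^sub>R particle \<Xi>' p"
    by (simp add: straight_path_def particle_add particle_scaleR scaleR_right_distrib)
  moreover have "0 \<le> (t + \<Delta>t - \<tau>) / \<Delta>t" "0 \<le> (\<tau> - t) / \<Delta>t"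
    using assms by (auto simp: zero_le_divide_iff min_def max_def split: if_splits)
  moreover have "(t + \<Delta>t - \<tau>) / \<Delta>t + (\<tau> - t) / \<Delta>t = 1"
    using dt by (simp add: field_simps)
  ultimately show ?thesis
    using convexD[OF convex_box(1)] assms by metis
qed

lemma straight_path_has_vector_derivative:
  "((\<lambda>\<tau>. particle (straight_path t \<Delta>t \<Xi> \<Xi>' \<tau>) p) has_vector_derivative
     particle ((1 / \<Delta>t) *\<^sub>R (\<Xi>' - \<Xi>)) p) (at \<tau> within S)"
proof -
  have "((\<lambda>\<tau>. (1 / \<Delta>t) *\<^sub>R ((t + \<Delta>t - \<tau>) *\<^sub>R particle \<Xi> p + (\<tau> - t) *\<^sub>R particle \<Xi>' p))
     has_vector_derivative (1 / \<Delta>t) *\<^sub>R (particle \<Xi>' p - particle \<Xi> p)) (at \<tau> within S)"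
    by (auto intro!: derivative_eq_intros simp: has_vector_derivative_def algebra_simps)
  moreover have "particle (\<Xi>' - \<Xi>) p = particle \<Xi>' p - particle \<Xi> p"
    by (simp add: particle_def vec_eq_iff)
  ultimately show ?thesis
    by (simp add: straight_path_def particle_add particle_scaleR)
qed

section \<open>Charge and current deposition\<close>

lemma MMq_mult: "MMq \<omega> q *v w = (\<chi> r. \<omega> (fst r) * q (fst r) * w $ r)"
proof -
  have "(\<Sum>c\<in>UNIV. (if fst r = fst c then \<omega> (fst r) * q (fst r) else 0) * (if snd r = snd c then 1 else 0) * w $ c)
     = \<omega> (fst r) * q (fst r) * w $ r" for r
  proof -
    have "(\<Sum>c\<in>UNIV. (if fst r = fst c then \<omega> (fst r) * q (fst r) else 0) * (if snd r = snd c then 1 else 0) * w $ c)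
       = (\<Sum>c\<in>UNIV. if c = r then \<omega> (fst r) * q (fst r) * w $ c else 0)"
      by (intro sum.cong) (auto simp: prod_eq_iff)
    then show ?thesis by simp
  qed
  then show ?thesis
    by (simp add: vec_eq_iff MMq_def kron_def diag_mat_def mat_def matrix_vector_mult_def)
qed

lemma block_diag_mult:
  "(block_diag A *v w) $ r = (A (fst r) *v particle w (fst r)) $ snd r"
proof -
  have "(block_diag A *v w) $ r =
     (\<Sum>p\<in>UNIV. \<Sum>k\<in>UNIV. (if fst r = p then A (fst r) $ snd r $ k else 0) * w $ (p, k))"
    by (simp add: block_diag_def matrix_vector_mult_def sum.cartesian_product UNIV_Times_UNIV
        case_prod_unfold)
  also have "\<dots> = (\<Sum>p\<in>UNIV. if p = fst r then (\<Sum>k\<in>UNIV. A (fst r) $ snd r $ k * w $ (p, k)) else 0)"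
    by (intro sum.cong) auto
  finally show ?thesis by (simp add: particle_def matrix_vector_mult_def)
qed

lemma transpose_block_diag: "transpose (block_diag A) = block_diag (\<lambda>p. transpose (A p))"
  by (auto simp: block_diag_def transpose_def vec_eq_iff)

text \<open>
  On the three components of each particle, \<open>MMq\<close> acts as multiplication by the scalar
  \<open>\<omega> p * q p\<close>.
\<close>

lemma MMq_commutes_block_diag:
  "block_diag A *v (MMq \<omega> q *v w) = MMq \<omega> q *v (block_diag A *v w)"
proof -
  have "particle (MMq \<omega> q *v w) p = (\<omega> p * q p) *\<^sub>R particle w p" for p
    by (simp add: particle_def MMq_mult vec_eq_iff)
  then have "(block_diag A *v (MMq \<omega> q *v w)) $ r = \<omega> (fst r) * q (fst r) * (block_diag A *v w) $ r" for r
    by (simp only: block_diag_mult matrix_vector_mult_scaleR vector_scaleR_component real_scaleR_def)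
  then show ?thesis
    by (simp add: vec_eq_iff MMq_mult[of \<omega> q "block_diag A *v w"])
qed

lemma charge_deposition:
  "(transpose (LL0 \<Lambda>0 \<Xi>) ** MMq0 \<omega> q) *v vec 1 = (\<Sum>p\<in>UNIV. (\<omega> p * q p) *\<^sub>R (\<Lambda>0 (particle \<Xi> p) $ 1))"
proof -
  have "MMq0 \<omega> q *v vec 1 = (\<chi> p. \<omega> p * q p)"
    by (simp add: MMq0_def diag_mat_def matrix_vector_mult_def vec_eq_iff)
  then have deposit: "(transpose (LL0 \<Lambda>0 \<Xi>) ** MMq0 \<omega> q) *v vec 1 =
      transpose (LL0 \<Lambda>0 \<Xi>) *v (\<chi> p. \<omega> p * q p)"
    by (simp only: matrix_vector_mul_assoc[symmetric])
  show ?thesis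
    unfolding deposit by (simp add: matrix_vector_mult_def transpose_def LL0_def vec_eq_iff mult.commute)
qed

lemma current_deposition:
  "transpose G *v (transpose (LL1 \<Lambda>1 \<Xi>) *v (MMq \<omega> q *v w)) =
    (\<Sum>p\<in>UNIV. (\<omega> p * q p) *\<^sub>R (transpose (\<Lambda>1 (particle \<Xi> p) ** G) *v particle w p))"
proof -
  have L: "transpose (LL1 \<Lambda>1 \<Xi>) *v (MMq \<omega> q *v w) =
      (\<Sum>p\<in>UNIV. (\<omega> p * q p) *\<^sub>R (transpose (\<Lambda>1 (particle \<Xi> p)) *v particle w p))"
  proof (subst vec_eq_iff, rule allI)
    fix j
    have "(transpose (LL1 \<Lambda>1 \<Xi>) *v (MMq \<omega> q *v w)) $ j =
        (\<Sum>r\<in>UNIV. \<Lambda>1 (particle \<Xi> (fst r)) $ snd r $ j * (\<omega> (fst r) * q (fst r) * w $ r))"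
      unfolding MMq_mult by (simp add: matrix_vector_mult_def transpose_def LL1_def stack_def)
    also have "\<dots> = (\<Sum>p\<in>UNIV. \<Sum>k\<in>UNIV. (\<omega> p * q p) * (\<Lambda>1 (particle \<Xi> p) $ k $ j * w $ (p, k)))"
      by (simp add: sum.cartesian_product UNIV_Times_UNIV case_prod_unfold mult.left_commute mult.assoc)
    also have "\<dots> =
      (\<Sum>p\<in>UNIV. (\<omega> p * q p) *\<^sub>R (transpose (\<Lambda>1 (particle \<Xi> p)) *v particle w p)) $ j"
      by (simp add: matrix_vector_mult_def transpose_def particle_def sum_distrib_left)
    finally show "(transpose (LL1 \<Lambda>1 \<Xi>) *v (MMq \<omega> q *v w)) $ j = \<dots>" .
  qed
  have "linear (\<lambda>v. transpose G *v v)" by (rule matrix_vector_mul_linear)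
  then show ?thesis
    unfolding L
    by (simp only: linear_sum[OF \<open>linear _\<close>] matrix_vector_mult_scaleR matrix_vector_mul_assoc
        matrix_transpose_mul)
qed

text \<open>
  The charge deposited along the straight paths is an antiderivative of the discrete divergence
  of the current: \<open>transpose G\<close> turns \<open>\<Lambda>1\<close> into the gradient of \<open>\<Lambda>0\<close>, and the chain rule along a
  path of constant velocity gives the time derivative. Conservation is exact because the current
  is integrated exactly in time.
\<close>

lemma discrete_continuity_equation:
  assumes dR: "discrete_de_rham \<Lambda>0 \<Lambda>1 \<Lambda>2 \<Lambda>3 G C D" and dt: "\<Delta>t \<noteq> 0"
    and pos: "\<And>p. particle \<Xi> p \<in> logical_cube" "\<And>p. particle \<Xi>' p \<in> logical_cube"
  shows "transpose G *v ((LBINT \<tau>=ereal t..ereal (t + \<Delta>t). transpose (LL1 \<Lambda>1 (straight_path t \<Delta>t \<Xi> \<Xi>' \<tau>)))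
            *v (MMq \<omega> q *v ((1 / \<Delta>t) *\<^sub>R (\<Xi>' - \<Xi>))))
     = (transpose (LL0 \<Lambda>0 \<Xi>') ** MMq0 \<omega> q) *v vec 1 - (transpose (LL0 \<Lambda>0 \<Xi>) ** MMq0 \<omega> q) *v vec 1"
proof -
  let ?P = "straight_path t \<Delta>t \<Xi> \<Xi>'"
  let ?w = "(1 / \<Delta>t) *\<^sub>R (\<Xi>' - \<Xi>)"
  let ?I = "{min t (t + \<Delta>t)..max t (t + \<Delta>t)}"
  let ?L = "\<lambda>\<tau>. transpose (LL1 \<Lambda>1 (?P \<tau>))"
  let ?T = "\<lambda>A. transpose G *v (A *v (MMq \<omega> q *v ?w))"
  let ?\<rho> = "\<lambda>\<tau>. \<Sum>p\<in>UNIV. (\<omega> p * q p) *\<^sub>R (\<Lambda>0 (particle (?P \<tau>) p) $ 1)"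
  have in_cube: "particle (?P \<tau>) p \<in> logical_cube" if "\<tau> \<in> ?I" for \<tau> p
    using that dt pos by (intro straight_path_in_cube) auto
  have path_cont: "continuous_on S (\<lambda>\<tau>. particle (?P \<tau>) p)" for p S
    unfolding continuous_on_eq_continuous_within
    by (intro ballI has_vector_derivative_continuous[OF straight_path_has_vector_derivative])
  have "continuous_on logical_cube \<Lambda>1"
    using dR unfolding discrete_de_rham_def by (blast intro: differentiable_imp_continuous_on)
  then have "continuous_on ?I (\<lambda>\<tau>. \<Lambda>1 (particle (?P \<tau>) p))" for p
    by (rule continuous_on_compose2[OF _ path_cont]) (auto intro: in_cube)
  then have L: "continuous_on ?I ?L"
    by (intro continuous_on_transpose)
      (auto simp: continuous_on_matrix_iff LL1_def stack_def)
  have "linear ?T"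
    by (intro linearI)
      (simp_all add: matrix_vector_mult_add_rdistrib matrix_vector_right_distrib
        scaleR_matrix_vector_assoc[symmetric] matrix_vector_mult_scaleR scaleR_right_distrib)
  then have T: "bounded_linear ?T" by (rule linear_conv_bounded_linear[THEN iffD1])
  have deriv: "(?\<rho> has_vector_derivative ?T (?L \<tau>)) (at \<tau> within ?I)" if \<tau>: "\<tau> \<in> ?I" for \<tau>
  proof -
    have "((\<lambda>\<tau>. \<Lambda>0 (particle (?P \<tau>) p) $ 1) has_vector_derivative
        transpose (\<Lambda>1 (particle (?P \<tau>) p) ** G) *v particle ?w p) (at \<tau> within ?I)" for p
    proof -
      have "((\<lambda>\<eta>. \<Lambda>0 \<eta> $ 1) has_derivative (\<lambda>v. transpose (\<Lambda>1 (particle (?P \<tau>) p) ** G) *v v))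
          (at (particle (?P \<tau>) p) within (\<lambda>\<tau>. particle (?P \<tau>) p) ` ?I)"
        by (rule has_derivative_subset[OF \<Lambda>0_has_derivative[OF dR in_cube[OF \<tau>]]]) (auto intro: in_cube)
      from vector_derivative_diff_chain_within[OF straight_path_has_vector_derivative this]
      show ?thesis by (simp add: o_def)
    qed
    then show ?thesis
      unfolding current_deposition
      by (intro has_vector_derivative_sum)
         (auto intro: bounded_linear.has_vector_derivative[OF bounded_linear_scaleR_right])
  qed
  have "?T (LBINT \<tau>=ereal t..ereal (t + \<Delta>t). ?L \<tau>) = (LBINT \<tau>=ereal t..ereal (t + \<Delta>t). ?T (?L \<tau>))"
    by (rule interval_integral_bounded_linear[OF T, symmetric])
       (rule interval_integrable_continuous_on_oriented[OF L])
  also have "\<dots> = ?\<rho> (t + \<Delta>t) - ?\<rho> t"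
  proof (rule interval_integral_FTC_finite)
    show "continuous_on ?I (\<lambda>\<tau>. ?T (?L \<tau>))"
      by (rule bounded_linear.continuous_on[OF T L])
  qed (use deriv in auto)
  also have "\<dots> = (\<Sum>p\<in>UNIV. (\<omega> p * q p) *\<^sub>R (\<Lambda>0 (particle \<Xi>' p) $ 1))
      - (\<Sum>p\<in>UNIV. (\<omega> p * q p) *\<^sub>R (\<Lambda>0 (particle \<Xi> p) $ 1))"
    using dt by (simp add: straight_path_def)
  finally show ?thesis unfolding charge_deposition .
qed

section \<open>Preservation of Gauss's law\<close>

text \<open>
  The position and field equations contain the same averages \<open>Nbar\<close> and \<open>Vbar\<close>. This is why
  the current in the field equation is the one transported along the straight paths, to which
  the discrete continuity equation applies.
\<close>

lemma update_S1_preserves_gauss_law: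
  assumes dR: "discrete_de_rham \<Lambda>0 \<Lambda>1 \<Lambda>2 \<Lambda>3 G C D" and dt: "\<Delta>t \<noteq> 0"
    and pos: "positions_in_cube s" "positions_in_cube s'"
    and upd: "update_S1 F \<Lambda>1 \<omega> m q t \<Delta>t s s'"
    and gauss: "gauss_law F \<Lambda>0 \<Lambda>1 G \<omega> q s"
  shows "gauss_law F \<Lambda>0 \<Lambda>1 G \<omega> q s'"
proof -
  obtain \<Xi> V e b where s: "s = (\<Xi>, V, e, b)" by (cases s)
  obtain \<Xi>' V' e' b' where s': "s' = (\<Xi>', V', e', b')" by (cases s')
  define I where "I = (LBINT \<tau>=ereal t..ereal (t + \<Delta>t). transpose (LL1 \<Lambda>1 (straight_path t \<Delta>t \<Xi> \<Xi>' \<tau>)))"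
  define Nbar where "Nbar = (1 / 2) *\<^sub>R (transpose (NN F \<Xi>) + transpose (NN F \<Xi>'))"
  define Vbar where "Vbar = (1 / 2) *\<^sub>R (V' + V)"
  let ?M = "M1 F \<Lambda>1"
  have pos_eq: "(1 / \<Delta>t) *\<^sub>R (\<Xi>' - \<Xi>) = Nbar *v Vbar"
    and "(1 / \<Delta>t) *\<^sub>R (?M *v e' - ?M *v e) = - ((((1 / \<Delta>t) *\<^sub>R I) ** Nbar ** MMq \<omega> q) *v Vbar)"
    using upd unfolding s s' I_def Nbar_def Vbar_def by simp_all
  then have "(1 / \<Delta>t) *\<^sub>R (?M *v e' - ?M *v e) = (1 / \<Delta>t) *\<^sub>R (- (I *v (Nbar *v (MMq \<omega> q *v Vbar))))"
    by (simp add: matrix_vector_mul_assoc[symmetric] scaleR_matrix_vector_assoc[symmetric])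
  then have ampere: "?M *v e' - ?M *v e = - (I *v (Nbar *v (MMq \<omega> q *v Vbar)))"
    using dt by (metis divide_eq_0_iff real_vector.scale_left_imp_eq zero_neq_one)
  have "Nbar *v (MMq \<omega> q *v Vbar) = MMq \<omega> q *v ((1 / \<Delta>t) *\<^sub>R (\<Xi>' - \<Xi>))"
    unfolding pos_eq
    by (simp add: Nbar_def NN_def transpose_block_diag scaleR_matrix_vector_assoc[symmetric]
        matrix_vector_mult_add_rdistrib matrix_vector_mult_scaleR matrix_vector_right_distrib
        MMq_commutes_block_diag)
  then have "?M *v e' = ?M *v e - I *v (MMq \<omega> q *v ((1 / \<Delta>t) *\<^sub>R (\<Xi>' - \<Xi>)))"
    using ampere by (simp only: diff_eq_eq) simp
  then have "transpose G *v (?M *v e') =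
      transpose G *v (?M *v e) - transpose G *v (I *v (MMq \<omega> q *v ((1 / \<Delta>t) *\<^sub>R (\<Xi>' - \<Xi>))))"
    by (simp only: matrix_vector_mult_diff_distrib)
  moreover have "transpose G *v (I *v (MMq \<omega> q *v ((1 / \<Delta>t) *\<^sub>R (\<Xi>' - \<Xi>)))) =
      (transpose (LL0 \<Lambda>0 \<Xi>') ** MMq0 \<omega> q) *v vec 1 - (transpose (LL0 \<Lambda>0 \<Xi>) ** MMq0 \<omega> q) *v vec 1"
    unfolding I_def using pos unfolding s s'
    by (intro discrete_continuity_equation[OF dR dt]) simp_all
  moreover have "transpose G *v (?M *v e) = - ((transpose (LL0 \<Lambda>0 \<Xi>) ** MMq0 \<omega> q) *v vec 1)"
    using gauss unfolding s by (simp add: matrix_vector_mul_assoc)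
  ultimately show ?thesis unfolding s' by (simp add: matrix_vector_mul_assoc[symmetric])
qed

text \<open>
  Membership of the positions in the cube is carried along as part of the invariant, since the
  gradient identity for the next particle update is available only there.
\<close>

lemma substep_preserves_gauss_law:
  fixes s s' :: "('p::finite, 'n1::finite, 'n2::finite) state"
  assumes F: "smooth_on F logical_cube" "\<And>\<xi>. \<xi> \<in> logical_cube \<Longrightarrow> J_F F \<xi> \<noteq> 0"
    and dR: "discrete_de_rham \<Lambda>0 \<Lambda>1 \<Lambda>2 \<Lambda>3 G C D"
    and step: "substep F \<Lambda>1 \<Lambda>2 C \<omega> m q s s'"
    and pos: "positions_in_cube s" and gauss: "gauss_law F \<Lambda>0 \<Lambda>1 G \<omega> q s"
  shows "positions_in_cube s' \<and> gauss_law F \<Lambda>0 \<Lambda>1 G \<omega> q s'"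
proof -
  obtain \<Xi> V e b where s: "s = (\<Xi>, V, e, b)" by (cases s)
  obtain \<Xi>' V' e' b' where s': "s' = (\<Xi>', V', e', b')" by (cases s')
  have cont: "continuous_on logical_cube \<Lambda>1" and indep: "lin_indep_family \<Lambda>1" and CG: "C ** G = 0"
    using dR unfolding discrete_de_rham_def by (blast intro: differentiable_imp_continuous_on)+
  obtain t \<Delta>t where dt: "\<Delta>t \<noteq> 0" and "update_S1 F \<Lambda>1 \<omega> m q t \<Delta>t s s' \<and> positions_in_cube s' \<or>
      update_S2 F \<Lambda>2 \<omega> m q \<Delta>t s s' \<or> update_S3 F \<Lambda>1 \<Lambda>2 C \<Delta>t s s'"
    using step unfolding substep_def by blast
  then consider (S1) "update_S1 F \<Lambda>1 \<omega> m q t \<Delta>t s s'" "positions_in_cube s'"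
    | (S2) "update_S2 F \<Lambda>2 \<omega> m q \<Delta>t s s'" | (S3) "update_S3 F \<Lambda>1 \<Lambda>2 C \<Delta>t s s'"
    by blast
  then show ?thesis
  proof cases
    case S1
    then show ?thesis using update_S1_preserves_gauss_law[OF dR dt pos _ _ gauss] by blast
  next
    case S2
    then show ?thesis using pos gauss unfolding s s' by simp
  next
    case S3
    have "(transpose G ** M1 F \<Lambda>1) *v e' = (transpose G ** M1 F \<Lambda>1) *v e"
      using update_S3_preserves_discrete_divergence[OF F cont indep CG] S3 unfolding s s' by blast
    moreover have "\<Xi>' = \<Xi>" using S3 unfolding s s' by simp
    ultimately show ?thesis using pos gauss unfolding s s' by simp
  qed
qed

theorem proposition5p4:
  fixes F :: "real^3 \<Rightarrow> real^3" and \<Omega> :: "(real^3) set"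
    and \<Lambda>0 :: "real^3 \<Rightarrow> real^'n0^1"
    and \<Lambda>1 :: "real^3 \<Rightarrow> real^(3 \<times> 'n1::finite)^3"
    and \<Lambda>2 :: "real^3 \<Rightarrow> real^(3 \<times> 'n2::finite)^3"
    and \<Lambda>3 :: "real^3 \<Rightarrow> real^'n3^1"
    and G :: "real^'n0^(3 \<times> 'n1)"
    and C :: "real^(3 \<times> 'n1)^(3 \<times> 'n2)"
    and D :: "real^(3 \<times> 'n2)^'n3"
    and \<omega> m q :: "'p::finite \<Rightarrow> real"
    and s\<^sub>0 s :: "('p, 'n1, 'n2) state"
  assumes "smooth_on F logical_cube"
    and "bij_betw F logical_cube \<Omega>"
    and "\<And>\<xi>. \<xi> \<in> logical_cube \<Longrightarrow> J_F F \<xi> \<noteq> 0"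
    and "discrete_de_rham \<Lambda>0 \<Lambda>1 \<Lambda>2 \<Lambda>3 G C D"
    and "\<And>p. \<omega> p > 0"
    and "\<And>p. m p > 0"
    and "positions_in_cube s\<^sub>0"
    and "(substep F \<Lambda>1 \<Lambda>2 C \<omega> m q)\<^sup>*\<^sup>* s\<^sub>0 s"
    and "gauss_law F \<Lambda>0 \<Lambda>1 G \<omega> q s\<^sub>0"
  shows "gauss_law F \<Lambda>0 \<Lambda>1 G \<omega> q s"
proof -
  have "positions_in_cube s \<and> gauss_law F \<Lambda>0 \<Lambda>1 G \<omega> q s"
    using assms(8)
  proof (induction rule: rtranclp_induct)
    case base
    then show ?case using assms(7,9) by blast
  next
    case (step s s')
    then show ?case using substep_preserves_gauss_law[OF assms(1,3,4)] by blast
  qed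
  then show ?thesis by blast
qed

end
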